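(* Fix either the unit-range normalization or the unit-sum normalization of valuation functions. Then: (i) There exist absolute constants $c, C > 0$ such that for every $n \ge 1$, the approximation ratio of random priority on $n$ agents and $n$ items satisfies $c/\sqrt{n} \le ar(RP) \le C/\sqrt{n}$, i.e. $ar(RP) = \Theta(n^{-1/2})$. (ii) There exists an absolute constant $C' > 0$ such that for every $n \ge 1$, every truthful-in-expectation mechanism $J$ (deterministic or randomized) for $n$ agents and $n$ items satisfies $ar(J) \le C'/\sqrt{n}$. (iii) There exists an absolute constant $C'' > 0$ such that for every $n \ge 1$, every ordinal mechanism $J$ (not necessarily truthful-in-expectation, deterministic or randomized) for $n$ agents and $n$ items satisfies $ar(J) \le C''/\sqrt{n}$.
   Context: Setting: a set of agents $N=\{1,\dots,n\}$ and a set of items $M=\{1,\dots,n\}$. An outcome is a matching, i.e. a bijection $\mu$ assigning to each agent $i$ a distinct item $\mu_i$; $O$ denotes the set of all outcomes. Each agent $i$ has a valuation function $u_i: M \to \mathbb{R}$ which is injective (no ties). Unit-range normalization: $\max_j u_i(j)=1$ and $\min_j u_i(j)=0$. Unit-sum normalization: $\sum_{j\in M} u_i(j) = 1$ (and values are nonnegative). $V$ denotes the set of admissible (normalized, injective) valuation functions and $V^n$ the set of valuation profiles $\mathbf u=(u_1,\dots,u_n)$. A (randomized) mechanism is a map $J$ assigning to every profile $\mathbf u\in V^n$ a probability distribution over $O$ (deterministic if the distribution is a point mass); $J(\mathbf u)_i$ is the (random) item assigned to agent $i$. $J$ is truthful-in-expectation if for every $i$, every $\mathbf u=(u_i,u_{-i})\in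 V^n$ and every $\tilde u_i\in V$, $\mathbb E[u_i(J(u_i,u_{-i})_i)] \ge \mathbb E[u_i(J(\tilde u_i,u_{-i})_i)]$. $J$ is ordinal if $J(u_i,u_{-i}) = J(u_i',u_{-i})$ (as distributions) whenever $u_i$ and $u_i'$ induce the same ordering of items. The approximation ratio is $ar(J)=\inf_{\mathbf u\in V^n} \mathbb E[\sum_i u_i(J(\mathbf u)_i)]/w^*(\mathbf u)$, where $w^*(\mathbf u)=\max_{\mu\in O}\sum_i u_i(\mu_i)$. Random priority (RP) picks a uniformly random ordering of the agents and then, in that order, assigns each agent its most preferred item among those not yet assigned.
   Formalization: Under the unit-range normalization the claims are stated for n ≥ 2 instead of n ≥ 1, because for n = 1 no valuation has both maximum 1 and minimum 0, so V is empty and the approximation ratio is an infimum over the empty set. *)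

theory Defs
  imports "HOL-Probability.Probability" "HOL-Combinatorics.Multiset_Permutations"
begin

text \<open>Agents and items are both represented by {..<n} (i.e. 0,...,n-1).
  A valuation is a function nat => real; to make profiles correspond
  bijectively to V^n we require valuations to vanish outside {..<n}
  and profiles to be constantly 0 for agents outside {..<n}.\<close>

datatype normalization = UnitRange | UnitSum

type_synonym valuation = "nat \<Rightarrow> real"
type_synonym profile = "nat \<Rightarrow> valuation"
type_synonym outcome = "nat \<Rightarrow> nat"
type_synonym mechanism = "profile \<Rightarrow> outcome pmf"

definition valid_valuation :: "normalization \<Rightarrow> nat \<Rightarrow> valuation \<Rightarrow> bool" where
  "valid_valuation nm n u \<longleftrightarrow>
     inj_on u {..<n} \<and> (\<forall>j. j \<ge> n \<longrightarrow> u j = 0) \<and>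
     (case nm of
        UnitRange \<Rightarrow> n > 0 \<and> Max (u ` {..<n}) = 1 \<and> Min (u ` {..<n}) = 0
      | UnitSum \<Rightarrow> (\<forall>j<n. u j \<ge> 0) \<and> (\<Sum>j<n. u j) = 1)"

definition profiles :: "normalization \<Rightarrow> nat \<Rightarrow> profile set" where
  "profiles nm n = {U. (\<forall>i<n. valid_valuation nm n (U i)) \<and> (\<forall>i. i \<ge> n \<longrightarrow> U i = (\<lambda>_. 0))}"

definition outcomes :: "nat \<Rightarrow> outcome set" where
  "outcomes n = {\<mu>. \<mu> permutes {..<n}}"

definition welfare :: "nat \<Rightarrow> profile \<Rightarrow> outcome \<Rightarrow> real" where
  "welfare n U \<mu> = (\<Sum>i<n. U i (\<mu> i))"

definition opt_welfare :: "nat \<Rightarrow> profile \<Rightarrow> real" where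
  "opt_welfare n U = Max (welfare n U ` outcomes n)"

definition is_mechanism :: "normalization \<Rightarrow> nat \<Rightarrow> mechanism \<Rightarrow> bool" where
  "is_mechanism nm n J \<longleftrightarrow> (\<forall>U \<in> profiles nm n. set_pmf (J U) \<subseteq> outcomes n)"

definition approx_ratio :: "normalization \<Rightarrow> nat \<Rightarrow> mechanism \<Rightarrow> real" where
  "approx_ratio nm n J =
     (INF U \<in> profiles nm n. measure_pmf.expectation (J U) (welfare n U) / opt_welfare n U)"

definition truthful_in_expectation :: "normalization \<Rightarrow> nat \<Rightarrow> mechanism \<Rightarrow> bool" where
  "truthful_in_expectation nm n J \<longleftrightarrow>
     (\<forall>i<n. \<forall>U \<in> profiles nm n. \<forall>v. valid_valuation nm n v \<longrightarrow>
        measure_pmf.expectation (J U) (\<lambda>\<mu>. U i (\<mu> i)) \<ge>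
        measure_pmf.expectation (J (U(i := v))) (\<lambda>\<mu>. U i (\<mu> i)))"

definition ordinal_mechanism :: "normalization \<Rightarrow> nat \<Rightarrow> mechanism \<Rightarrow> bool" where
  "ordinal_mechanism nm n J \<longleftrightarrow>
     (\<forall>i<n. \<forall>U \<in> profiles nm n. \<forall>v. valid_valuation nm n v \<longrightarrow>
        (\<forall>j<n. \<forall>k<n. U i j < U i k \<longleftrightarrow> v j < v k) \<longrightarrow> J (U(i := v)) = J U)"

fun serial_dictatorship :: "profile \<Rightarrow> nat list \<Rightarrow> nat set \<Rightarrow> outcome" where
  "serial_dictatorship U [] A = id"
| "serial_dictatorship U (i # is) A =
     (let j = (ARG_MAX (U i) j. j \<in> A) in (serial_dictatorship U is (A - {j}))(i := j))"

definition random_priority :: "nat \<Rightarrow> mechanism" where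
  "random_priority n U =
     map_pmf (\<lambda>order. serial_dictatorship U order {..<n})
             (pmf_of_set (permutations_of_set {..<n}))"

text \<open>Values of n for which V^n is non-empty (unit-range needs at least two items).\<close>
definition admissible_size :: "normalization \<Rightarrow> nat \<Rightarrow> bool" where
  "admissible_size nm n \<longleftrightarrow> n \<ge> 1 \<and> (nm = UnitRange \<longrightarrow> n \<ge> 2)"

end

theory Submission
  imports Defs
begin

text \<open>
  Lower bound for random priority. Splitting off the first agent shows by induction that the expected
  welfare is at least \<open>1/n\<close> times the sum of the values of all (agent, item) pairs, which is at
  least \<open>1\<close> under either normalization. It is also at least \<open>w\<^sup>2/(4n)\<close> for every matching of welfare \<open>w\<close>: each step
  destroys at most two edges of the matching, of value at most \<open>1\<close> each, while the agent who moves
  obtains on average at least \<open>1/n\<close> of what is left. The two bounds together give the ratio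
  \<open>1/(2\<surd>n)\<close>.

  Upper bounds. Both truthful and ordinal mechanisms satisfy: no agent gains by reporting
  a different valuation that induces the same order of items. With \<open>k\<close> about \<open>\<surd>n\<close>, a set \<open>T\<close> of \<open>k\<close>
  special agents is planted among agents whose valuations are so flat that they contribute
  a bounded amount of welfare. A flat agent does not gain by posing as special, so a special agent
  is hardly more likely to get a desired item than a flat one in its place; averaged over
  the choices of \<open>T\<close>, the special agents get a bounded number of desired items, while
  the optimum serves all \<open>k\<close> of them.
\<close>

section \<open>Serial dictatorship\<close>

lemma ARG_MAX_finite:
  fixes f :: "'a \<Rightarrow> real"
  assumes "finite A" "A \<noteq> {}"
  shows ARG_MAX_finite_mem: "(ARG_MAX f j. j \<in> A) \<in> A"
    and ARG_MAX_finite_ge: "\<And>x. x \<in> A \<Longrightarrow> f x \<le> f (ARG_MAX f j. j \<in> A)"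
proof -
  have "Max (f ` A) \<in> f ` A" using assms by (intro Max_in) auto
  then obtain a where a: "a \<in> A" "f a = Max (f ` A)" by auto
  have "is_arg_max f (\<lambda>j. j \<in> A) a"
    using a assms by (auto simp: is_arg_max_def not_less)
  then have *: "is_arg_max f (\<lambda>j. j \<in> A) (ARG_MAX f j. j \<in> A)"
    unfolding arg_max_def by (rule someI)
  show "(ARG_MAX f j. j \<in> A) \<in> A" using * by (simp add: is_arg_max_def)
  show "\<And>x. x \<in> A \<Longrightarrow> f x \<le> f (ARG_MAX f j. j \<in> A)"
    using * by (auto simp: is_arg_max_def not_less)
qed

text \<open>The expected welfare of random priority run on agents \<open>R\<close> and items
  \<open>A\<close>. Once an agent has moved, what remains is again of this form, which allows
  induction on \<open>card R\<close>.\<close>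

definition rp_value :: "profile \<Rightarrow> nat set \<Rightarrow> nat set \<Rightarrow> real" where
  "rp_value U R A =
     (\<Sum>os\<in>permutations_of_set R. \<Sum>i\<in>R. U i (serial_dictatorship U os A i)) / fact (card R)"

lemma rp_value_empty [simp]: "rp_value U {} A = 0"
  by (simp add: rp_value_def)

text \<open>Condition on the first agent \<open>i\<close>: the orders starting with \<open>i\<close>
  are \<open>i # os\<close> with \<open>os\<close> an order of \<open>R - {i}\<close>, and all first
  agents are equally likely.\<close>

lemma rp_value_rec:
  fixes U :: profile and A :: "nat set"
  assumes "finite R" "R \<noteq> {}"
  defines "b \<equiv> \<lambda>i. ARG_MAX (U i) j. j \<in> A"
  shows "rp_value U R A =
    (\<Sum>i\<in>R. U i (b i) + rp_value U (R - {i}) (A - {b i})) / card R"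
proof -
  define W where "W = (\<lambda>R A. \<Sum>os\<in>permutations_of_set R. \<Sum>i\<in>R. U i (serial_dictatorship U os A i))"
  obtain m where m: "card R = Suc m" using assms by (metis card_eq_0_iff not0_implies_Suc)
  have W_rp: "W R' A' = fact (card R') * rp_value U R' A'" for R' A'
    by (simp add: W_def rp_value_def)
  have "W R A = (\<Sum>i\<in>R. \<Sum>os\<in>(#) i ` permutations_of_set (R - {i}). \<Sum>i'\<in>R. U i' (serial_dictatorship U os A i'))"
    unfolding W_def permutations_of_set_nonempty[OF assms(2)]
    using assms(1) by (intro sum.UNION_disjoint) auto
  also have "\<dots> = (\<Sum>i\<in>R. fact m * U i (b i) + W (R - {i}) (A - {b i}))"
  proof (intro sum.cong refl)
    fix i assume i: "i \<in> R"
    have "(\<Sum>os\<in>(#) i ` permutations_of_set (R - {i}). \<Sum>i'\<in>R. U i' (serial_dictatorship U os A i'))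
        = (\<Sum>os\<in>permutations_of_set (R - {i}). \<Sum>i'\<in>R. U i' (serial_dictatorship U (i # os) A i'))"
      by (subst sum.reindex) (auto simp: inj_on_def)
    also have "\<dots> = (\<Sum>os\<in>permutations_of_set (R - {i}).
        U i (b i) + (\<Sum>i'\<in>R-{i}. U i' (serial_dictatorship U os (A - {b i}) i')))"
      using i assms(1) by (intro sum.cong refl) (auto simp: sum.remove b_def Let_def)
    also have "\<dots> = fact m * U i (b i) + W (R - {i}) (A - {b i})"
      using i m assms(1) by (simp add: sum.distrib W_def card_Diff_singleton)
    finally show "(\<Sum>os\<in>(#) i ` permutations_of_set (R - {i}). \<Sum>i'\<in>R. U i' (serial_dictatorship U os A i'))
        = fact m * U i (b i) + W (R - {i}) (A - {b i})" .
  qed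
  also have "\<dots> = fact m * (\<Sum>i\<in>R. U i (b i) + rp_value U (R - {i}) (A - {b i}))"
    using m assms(1) by (simp add: W_rp sum_distrib_left algebra_simps)
  finally have "fact m * (Suc m * rp_value U R A) =
      fact m * (\<Sum>i\<in>R. U i (b i) + rp_value U (R - {i}) (A - {b i}))"
    by (simp add: W_rp m algebra_simps)
  then have "Suc m * rp_value U R A = (\<Sum>i\<in>R. U i (b i) + rp_value U (R - {i}) (A - {b i}))"
    by (subst (asm) mult_left_cancel) auto
  then show ?thesis
    unfolding m by (metis nonzero_mult_div_cancel_left of_nat_eq_0_iff nat.distinct(1))
qed

text \<open>Let \<open>S i'\<close> be the total value of \<open>A\<close> to agent
  \<open>i'\<close> and \<open>M i'\<close> its best value there. Losing item \<open>b i\<close>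
  costs \<open>i'\<close> at most \<open>M i'\<close>, so by induction the rest yields at least
  \<open>1/m\<close> times the sum of \<open>S i' - M i'\<close>. Over all first agents, each
  \<open>i'\<close> stays behind \<open>m\<close> times, which cancels \<open>1/m\<close>, and the
  \<open>M i'\<close> collected by first movers restore the sum of \<open>S i'\<close>.\<close>

lemma rp_value_ge_average:
  assumes "finite R" "finite A" "card R = card A"
  shows "(\<Sum>i\<in>R. \<Sum>j\<in>A. U i j) / card A \<le> rp_value U R A"
  using assms
proof (induction "card R" arbitrary: R A)
  case 0
  then show ?case by simp
next
  case (Suc m)
  define b where "b = (\<lambda>i. ARG_MAX (U i) j. j \<in> A)"
  define M where "M = (\<lambda>i. U i (b i))"
  define S where "S = (\<lambda>i. \<Sum>j\<in>A. U i j)"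
  have ne: "R \<noteq> {}" "A \<noteq> {}" using Suc.hyps(2) Suc.prems by auto
  have bA: "b i \<in> A" and bmax: "j \<in> A \<Longrightarrow> U i j \<le> M i" for i j
    unfolding M_def b_def using ARG_MAX_finite[OF Suc.prems(2) ne(2)] by auto
  have IH: "(\<Sum>i'\<in>R-{i}. S i' - M i') / m \<le> rp_value U (R - {i}) (A - {b i})" if i: "i \<in> R" for i
  proof -
    have "(\<Sum>i'\<in>R-{i}. S i' - M i') / m \<le> (\<Sum>i'\<in>R-{i}. \<Sum>j\<in>A-{b i}. U i' j) / m"
      using bA bmax Suc.prems
      by (intro divide_right_mono sum_mono) (auto simp: S_def sum_diff1)
    also have "\<dots> \<le> rp_value U (R - {i}) (A - {b i})"
    proof -
      have c: "m = card (R - {i})" "card (A - {b i}) = m"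
        using i bA[of i] Suc.hyps(2) Suc.prems by auto
      show ?thesis
        using Suc.hyps(1)[OF c(1), of "A - {b i}"] c Suc.prems(1,2)
        by (metis finite_Diff)
    qed
    finally show ?thesis .
  qed
  have rest: "(\<Sum>i\<in>R. (\<Sum>i'\<in>R-{i}. S i' - M i') / m) = (\<Sum>i\<in>R. S i - M i)"
  \<comment> \<open>Division by \<open>m = 0\<close> yields 0 on the left; on the right the only
    item of \<open>A\<close> is \<open>b i\<close>, so \<open>S i = M i\<close>.\<close>
  proof (cases "m = 0")
    case True
    then have "card A = 1" using Suc by simp
    then obtain a where "A = {a}" by (auto simp: card_1_singleton_iff)
    then show ?thesis using True bA by (auto simp: S_def M_def)
  next
    case False
    have "(\<Sum>i\<in>R. \<Sum>i'\<in>R-{i}. S i' - M i') = (\<Sum>i\<in>R. (\<Sum>i'\<in>R. S i' - M i') - (S i - M i))"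
      using Suc.prems by (intro sum.cong refl) (simp add: sum_diff1)
    also have "\<dots> = m * (\<Sum>i\<in>R. S i - M i)"
      using Suc.hyps(2)[symmetric]
      by (subst sum_subtractf) (simp add: algebra_simps)
    finally show ?thesis using False by (simp flip: sum_divide_distrib)
  qed
  have "(\<Sum>i\<in>R. S i) = (\<Sum>i\<in>R. M i) + (\<Sum>i\<in>R. (\<Sum>i'\<in>R-{i}. S i' - M i') / m)"
    unfolding rest by (simp add: sum_subtractf)
  also have "\<dots> \<le> (\<Sum>i\<in>R. U i (b i) + rp_value U (R - {i}) (A - {b i}))"
    unfolding sum.distrib[symmetric] using IH by (intro sum_mono add_mono) (auto simp: M_def)
  finally show ?case
    using rp_value_rec[OF Suc.prems(1) ne(1), of U A] Suc.prems(3)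
    by (simp add: b_def S_def divide_right_mono)
qed

text \<open>Only edges of \<open>\<mu>\<close> with both ends still present count, and
  \<open>N\<close> stays fixed while \<open>R\<close> shrinks. With \<open>w\<close> the value of
  these edges, the recursion closes because \<open>w^2 - (w - 2)^2 \<le> 4 * w\<close>, where
  \<open>w - 2\<close> is cut off at 0: the quadratic bound drops by at most \<open>w / N\<close>,
  and the first mover gets on average at least \<open>w / card R\<close>.\<close>

lemma rp_value_ge_square:
  fixes N :: nat
  assumes "finite R" "finite A" "card R = card A" "card R \<le> N" "inj_on \<mu> R"
    and "\<And>i j. i \<in> R \<Longrightarrow> j \<in> A \<Longrightarrow> 0 \<le> U i j \<and> U i j \<le> 1"
  shows "(\<Sum>i\<in>{i\<in>R. \<mu> i \<in> A}. U i (\<mu> i))\<^sup>2 / (4 * N) \<le> rp_value U R A"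
  using assms
proof (induction "card R" arbitrary: R A)
  case 0
  then show ?case by simp
next
  case (Suc m)
  define b where "b = (\<lambda>i. ARG_MAX (U i) j. j \<in> A)"
  define w where "w = (\<lambda>R A. \<Sum>i\<in>{i\<in>R. \<mu> i \<in> A}. U i (\<mu> i))"
  have ne: "R \<noteq> {}" "A \<noteq> {}" using Suc.hyps(2) Suc.prems by auto
  have bA: "b i \<in> A" and bmax: "j \<in> A \<Longrightarrow> U i j \<le> U i (b i)" for i j
    unfolding b_def using ARG_MAX_finite[OF Suc.prems(2) ne(2)] by auto
  have N: "0 < card R" "card R \<le> N" using Suc.hyps(2) Suc.prems by auto
  have w0: "0 \<le> w R A" unfolding w_def using Suc.prems(6) by (intro sum_nonneg) auto
  \<comment> \<open>The edges lost are those at agent \<open>i\<close> and at item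
    \<open>b i\<close>, at most two since \<open>\<mu>\<close> is injective on \<open>R\<close>,
    each of value at most 1. Truncation at 0 keeps squaring monotone.\<close>
  have step: "(max 0 (w R A - 2))\<^sup>2 / (4 * N) \<le> rp_value U (R - {i}) (A - {b i})" if i: "i \<in> R" for i
  proof -
    let ?X = "{i \<in> R. \<mu> i \<in> A}" and ?Y = "{i' \<in> R - {i}. \<mu> i' \<in> A - {b i}}"
    have "?X - ?Y \<subseteq> {i} \<union> {i' \<in> R. \<mu> i' = b i}" by auto
    then have "card (?X - ?Y) \<le> card ({i} \<union> {i' \<in> R. \<mu> i' = b i})"
      using Suc.prems(1) by (intro card_mono) auto
    also have "\<dots> \<le> card {i} + card {i' \<in> R. \<mu> i' = b i}" by (rule card_Un_le)
    also have "card {i' \<in> R. \<mu> i' = b i} \<le> 1"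
      using Suc.prems(1,5) by (auto simp: card_le_Suc0_iff_eq inj_on_def)
    finally have c2: "card (?X - ?Y) \<le> 2" by simp
    have "w R A = w (R - {i}) (A - {b i}) + (\<Sum>i\<in>?X-?Y. U i (\<mu> i))"
      unfolding w_def using Suc.prems(1) by (subst sum.subset_diff[of ?Y]) auto
    also have "(\<Sum>i\<in>?X-?Y. U i (\<mu> i)) \<le> of_nat (card (?X - ?Y)) * 1"
      using Suc.prems(6) by (intro sum_bounded_above) auto
    finally have "w R A - 2 \<le> w (R - {i}) (A - {b i})" using c2 by simp
    moreover have "0 \<le> w (R - {i}) (A - {b i})"
      unfolding w_def using Suc.prems(6) by (intro sum_nonneg) auto
    ultimately have "(max 0 (w R A - 2))\<^sup>2 / (4 * N) \<le> (w (R - {i}) (A - {b i}))\<^sup>2 / (4 * N)"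
      by (intro divide_right_mono power_mono) auto
    also have "\<dots> \<le> rp_value U (R - {i}) (A - {b i})"
      unfolding w_def
    proof (rule Suc.hyps(1))
      show "m = card (R - {i})" using i Suc.hyps(2) Suc.prems(1) by simp
      show "card (R - {i}) = card (A - {b i})" using i bA Suc.prems by simp
      show "card (R - {i}) \<le> N" using Suc.prems(1,4) card_Diff1_le[of R i] by linarith
      show "inj_on \<mu> (R - {i})" using Suc.prems(5) by (rule inj_on_subset) auto
    qed (use Suc.prems in auto)
    finally show ?thesis .
  qed
  have "w R A = (\<Sum>i\<in>R. if \<mu> i \<in> A then U i (\<mu> i) else 0)"
    unfolding w_def using Suc.prems(1) by (simp add: sum.inter_filter)
  also have "\<dots> \<le> (\<Sum>i\<in>R. U i (b i))"
    using bA bmax Suc.prems(6) by (intro sum_mono) auto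
  finally have first: "w R A \<le> (\<Sum>i\<in>R. U i (b i))" .
  have "(w R A)\<^sup>2 \<le> 4 * w R A + (max 0 (w R A - 2))\<^sup>2"
  proof (cases "w R A \<le> 2")
    case True
    then have "w R A * w R A \<le> 4 * w R A" using w0 by (intro mult_right_mono) auto
    then show ?thesis using True by (simp add: power2_eq_square)
  next
    case False
    then show ?thesis by (simp add: power2_eq_square algebra_simps)
  qed
  then have "(w R A)\<^sup>2 / (4 * N) \<le> (4 * w R A + (max 0 (w R A - 2))\<^sup>2) / (4 * N)"
    by (intro divide_right_mono) auto
  also have "\<dots> = w R A / N + (max 0 (w R A - 2))\<^sup>2 / (4 * N)"
    using N by (simp add: field_simps)
  also have "\<dots> \<le> w R A / card R + (max 0 (w R A - 2))\<^sup>2 / (4 * N)"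
    using N w0 by (intro add_right_mono divide_left_mono) auto
  also have "\<dots> = (w R A + (\<Sum>i\<in>R. (max 0 (w R A - 2))\<^sup>2 / (4 * N))) / card R"
    using N by (simp add: field_simps)
  also have "\<dots> \<le> (\<Sum>i\<in>R. U i (b i) + rp_value U (R - {i}) (A - {b i})) / card R"
    unfolding sum.distrib using first step by (intro divide_right_mono add_mono sum_mono) auto
  also have "\<dots> = rp_value U R A"
    using rp_value_rec[OF Suc.prems(1) ne(1), of U A] by (simp add: b_def)
  finally show ?case by (simp add: w_def)
qed

section \<open>Random priority as an ordinal mechanism\<close>

lemma serial_dictatorship_outside: "i \<notin> set os \<Longrightarrow> serial_dictatorship U os A i = i"
  by (induction os arbitrary: A) (auto simp: Let_def)

lemma serial_dictatorship_bij_betw: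
  assumes "distinct os" "finite A" "length os = card A"
  shows "bij_betw (serial_dictatorship U os A) (set os) A"
  using assms
proof (induction os arbitrary: A)
  case Nil
  then show ?case by (simp add: bij_betw_def)
next
  case (Cons i os)
  define b where "b = (ARG_MAX (U i) j. j \<in> A)"
  have b: "b \<in> A" unfolding b_def using Cons.prems by (intro ARG_MAX_finite_mem) auto
  have "bij_betw (serial_dictatorship U os (A - {b})) (set os) (A - {b})"
    using Cons b by auto
  then have "bij_betw (serial_dictatorship U (i # os) A) (set os) (A - {b})"
    using Cons.prems by (subst bij_betw_cong[where g = "serial_dictatorship U os (A - {b})"])
      (auto simp: b_def Let_def)
  moreover have "serial_dictatorship U (i # os) A i = b" by (simp add: b_def Let_def)
  ultimately have "bij_betw (serial_dictatorship U (i # os) A) (insert i (set os)) (insert b (A - {b}))"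
    using notIn_Un_bij_betw[of i "set os" "serial_dictatorship U (i # os) A" "A - {b}"] Cons.prems
    by simp
  then show ?case using b by (simp add: insert_absorb)
qed

lemma set_pmf_random_priority:
  "set_pmf (random_priority n U) =
     (\<lambda>os. serial_dictatorship U os {..<n}) ` permutations_of_set {..<n}"
  by (simp add: random_priority_def)

lemma is_mechanism_random_priority: "is_mechanism nm n (random_priority n)"
proof -
  have "serial_dictatorship U os {..<n} permutes {..<n}" if "os \<in> permutations_of_set {..<n}" for U os
    using that serial_dictatorship_bij_betw[of os "{..<n}" U]
      length_finite_permutations_of_set[OF that]
    by (intro bij_imp_permutes serial_dictatorship_outside) (auto simp: permutations_of_set_def)
  then show ?thesis
    by (auto simp: is_mechanism_def outcomes_def set_pmf_random_priority)
qed

lemma serial_dictatorship_cong_order: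
  assumes "A \<subseteq> B" "\<And>i j k. j \<in> B \<Longrightarrow> k \<in> B \<Longrightarrow> U i j < U i k \<longleftrightarrow> V i j < V i k"
  shows "serial_dictatorship U os A = serial_dictatorship V os A"
  using assms(1)
proof (induction os arbitrary: A)
  case Nil
  then show ?case by simp
next
  case (Cons i os)
  \<comment> \<open>The order on \<open>A\<close> determines the whole predicate
    \<open>is_arg_max\<close>, so the choice operator behind \<open>ARG_MAX\<close> selects the same
    item even if \<open>A\<close> is empty or has ties.\<close>
  have "is_arg_max (U i) (\<lambda>j. j \<in> A) = is_arg_max (V i) (\<lambda>j. j \<in> A)"
    using assms(2)[of _ _ i] Cons.prems by (auto simp: is_arg_max_def fun_eq_iff subset_iff)
  then have "(ARG_MAX (U i) j. j \<in> A) = (ARG_MAX (V i) j. j \<in> A)"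
    by (simp add: arg_max_def)
  moreover have "serial_dictatorship U os (A - {ARG_MAX (V i) j. j \<in> A})
      = serial_dictatorship V os (A - {ARG_MAX (V i) j. j \<in> A})"
    using Cons.prems by (intro Cons.IH) auto
  ultimately show ?case by (simp add: Let_def)
qed

lemma ordinal_mechanism_random_priority: "ordinal_mechanism nm n (random_priority n)"
  unfolding ordinal_mechanism_def random_priority_def
proof (intro allI impI ballI)
  fix i and U :: profile and v :: valuation
  assume "\<forall>j<n. \<forall>k<n. U i j < U i k \<longleftrightarrow> v j < v k"
  then have "serial_dictatorship (U(i := v)) os {..<n} = serial_dictatorship U os {..<n}" for os
    by (intro serial_dictatorship_cong_order[where B = "{..<n}"]) auto
  then show "map_pmf (\<lambda>os. serial_dictatorship (U(i := v)) os {..<n}) (pmf_of_set (permutations_of_set {..<n}))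
      = map_pmf (\<lambda>os. serial_dictatorship U os {..<n}) (pmf_of_set (permutations_of_set {..<n}))"
    by simp
qed

section \<open>Valuations, welfare and approximation ratio\<close>

lemma finite_outcomes: "finite (outcomes n)"
  unfolding outcomes_def by (rule finite_permutations) simp

lemma id_in_outcomes: "id \<in> outcomes n"
  by (simp add: outcomes_def permutes_id)

lemma integrable_mechanism:
  fixes f :: "outcome \<Rightarrow> real"
  assumes "is_mechanism nm n J" "U \<in> profiles nm n"
  shows "integrable (measure_pmf (J U)) f"
  using assms finite_outcomes[of n]
  by (intro integrable_measure_pmf_finite) (auto simp: is_mechanism_def intro: finite_subset)

lemma expectation_mono_outcomes:
  fixes f g :: "outcome \<Rightarrow> real"
  assumes "is_mechanism nm n J" "U \<in> profiles nm n"
    and "\<And>\<mu>. \<mu> permutes {..<n} \<Longrightarrow> f \<mu> \<le> g \<mu>"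
  shows "measure_pmf.expectation (J U) f \<le> measure_pmf.expectation (J U) g"
  using assms
  by (intro integral_mono_AE integrable_mechanism[OF assms(1,2)] AE_pmfI)
    (auto simp: is_mechanism_def outcomes_def)

lemma welfare_le_opt: "\<mu> \<in> outcomes n \<Longrightarrow> welfare n U \<mu> \<le> opt_welfare n U"
  unfolding opt_welfare_def using finite_outcomes[of n] by (intro Max_ge) auto

text \<open>A partial matching \<open>f\<close> on \<open>T\<close> extends by any bijection between
  the remaining agents and items, and nonnegative values make the extension cost nothing.\<close>

lemma opt_welfare_ge_partial:
  assumes U: "\<And>i j. i < n \<Longrightarrow> j < n \<Longrightarrow> 0 \<le> U i j"
    and T: "T \<subseteq> {..<n}" and f: "inj_on f T" "f ` T \<subseteq> {..<n}"
  shows "(\<Sum>i\<in>T. U i (f i)) \<le> opt_welfare n U"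
proof -
  have fin: "finite T" using T by (rule finite_subset) simp
  have "card ({..<n} - T) = card ({..<n} - f ` T)"
    using T f fin by (simp add: card_Diff_subset card_image)
  then obtain h where h: "bij_betw h ({..<n} - T) ({..<n} - f ` T)"
    using finite_same_card_bij[of "{..<n} - T" "{..<n} - f ` T"] by auto
  define \<mu> where "\<mu> = (\<lambda>i. if i \<in> T then f i else if i < n then h i else i)"
  have "bij_betw \<mu> T (f ` T)"
    using f by (subst bij_betw_cong[where g = f]) (auto simp: \<mu>_def bij_betw_def)
  moreover have "bij_betw \<mu> ({..<n} - T) ({..<n} - f ` T)"
    using h by (subst bij_betw_cong[where g = h]) (auto simp: \<mu>_def)
  ultimately have "bij_betw \<mu> (T \<union> ({..<n} - T)) (f ` T \<union> ({..<n} - f ` T))"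
    by (rule bij_betw_combine) auto
  moreover have "T \<union> ({..<n} - T) = {..<n}" "f ` T \<union> ({..<n} - f ` T) = {..<n}"
    using T f by auto
  ultimately have "\<mu> permutes {..<n}"
    using T by (intro bij_imp_permutes) (auto simp: \<mu>_def)
  then have \<mu>: "\<mu> \<in> outcomes n" by (simp add: outcomes_def)
  have "(\<Sum>i\<in>T. U i (f i)) = (\<Sum>i\<in>T. U i (\<mu> i))" by (simp add: \<mu>_def)
  also have "\<dots> \<le> welfare n U \<mu>"
    unfolding welfare_def using T U permutes_in_image[OF \<open>\<mu> permutes {..<n}\<close>]
    by (intro sum_mono2) auto
  also have "\<dots> \<le> opt_welfare n U" using \<mu> by (rule welfare_le_opt)
  finally show ?thesis .
qed

lemma valid_valuation_bounds:
  assumes "valid_valuation nm n u" "j < n"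
  shows "0 \<le> u j" "u j \<le> 1"
proof -
  have "0 \<le> u j \<and> u j \<le> 1"
  proof (cases nm)
    case UnitRange
    then have "Max (u ` {..<n}) = 1" "Min (u ` {..<n}) = 0"
      using assms(1) by (auto simp: valid_valuation_def)
    moreover have "u j \<le> Max (u ` {..<n})" "Min (u ` {..<n}) \<le> u j"
      using assms(2) by (auto intro: Max_ge Min_le)
    ultimately show ?thesis by simp
  next
    case UnitSum
    then have *: "\<forall>j<n. 0 \<le> u j" "(\<Sum>j<n. u j) = 1"
      using assms(1) by (auto simp: valid_valuation_def)
    then have "u j \<le> (\<Sum>j<n. u j)" using assms(2) by (intro member_le_sum) auto
    then show ?thesis using * assms(2) by auto
  qed
  then show "0 \<le> u j" "u j \<le> 1" by auto
qed

lemma valid_valuation_sum_ge_1: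
  assumes "valid_valuation nm n u"
  shows "1 \<le> (\<Sum>j<n. u j)"
proof (cases nm)
  case UnitRange
  then have "n > 0" "Max (u ` {..<n}) = 1" using assms by (auto simp: valid_valuation_def)
  then have "1 \<in> u ` {..<n}" using Max_in[of "u ` {..<n}"] by fastforce
  then obtain j where "j < n" "u j = 1" by auto
  moreover have "u j \<le> (\<Sum>j<n. u j)"
    using \<open>j < n\<close> valid_valuation_bounds[OF assms] by (intro member_le_sum) auto
  ultimately show ?thesis by simp
next
  case UnitSum
  then show ?thesis using assms by (simp add: valid_valuation_def)
qed

lemma profiles_bounds:
  assumes "U \<in> profiles nm n" "i < n" "j < n"
  shows "0 \<le> U i j" "U i j \<le> 1"
  using assms valid_valuation_bounds[of nm n "U i" j] by (auto simp: profiles_def)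

lemma expectation_le_opt:
  assumes "is_mechanism nm n J" "U \<in> profiles nm n"
  shows "measure_pmf.expectation (J U) (welfare n U) \<le> opt_welfare n U"
  using expectation_mono_outcomes[OF assms, of "welfare n U" "\<lambda>_. opt_welfare n U"] welfare_le_opt
  by (simp add: outcomes_def)

lemma approx_ratio_le:
  assumes J: "is_mechanism nm n J" and U: "U \<in> profiles nm n"
    and E: "measure_pmf.expectation (J U) (welfare n U) \<le> a"
    and opt: "b \<le> opt_welfare n U" and "b > 0"
  shows "approx_ratio nm n J \<le> a / b"
proof -
  have nonneg: "0 \<le> measure_pmf.expectation (J V) (welfare n V)" if "V \<in> profiles nm n" for V
  proof -
    have "0 \<le> welfare n V \<mu>" if "\<mu> permutes {..<n}" for \<mu>
      unfolding welfare_def using permutes_in_image[OF that] profiles_bounds(1)[OF \<open>V \<in> profiles nm n\<close>]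
      by (intro sum_nonneg) auto
    then show ?thesis
      using expectation_mono_outcomes[OF J that, of "\<lambda>_. 0" "welfare n V"] by simp
  qed
  have opt0: "0 \<le> opt_welfare n V" if "V \<in> profiles nm n" for V
    using nonneg[OF that] expectation_le_opt[OF J that] by simp
  \<comment> \<open>Nonnegativity of all ratios bounds the set below, so that the real infimum lies
    below each member.\<close>
  have "approx_ratio nm n J \<le> measure_pmf.expectation (J U) (welfare n U) / opt_welfare n U"
    unfolding approx_ratio_def
    by (rule cINF_lower[OF _ U]) (auto intro!: bdd_belowI2[where m = 0] divide_nonneg_nonneg nonneg opt0)
  also have "\<dots> \<le> a / b"
    using E opt nonneg[OF U] \<open>b > 0\<close> by (intro frac_le) auto
  finally show ?thesis .
qed

section \<open>Lower bound for random priority\<close>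

lemma expectation_random_priority:
  "measure_pmf.expectation (random_priority n U) (welfare n U) = rp_value U {..<n} {..<n}"
  by (simp add: random_priority_def integral_pmf_of_set rp_value_def welfare_def)

lemma random_priority_welfare_ge:
  assumes "U \<in> profiles nm n" "n > 0"
  defines "E \<equiv> measure_pmf.expectation (random_priority n U) (welfare n U)"
  shows random_priority_welfare_ge_1: "1 \<le> E"
    and random_priority_welfare_ge_opt: "opt_welfare n U \<le> 2 * sqrt n * E"
proof -
  have val: "valid_valuation nm n (U i)" if "i < n" for i
    using assms(1) that by (auto simp: profiles_def)
  have E: "E = rp_value U {..<n} {..<n}" unfolding E_def by (rule expectation_random_priority)
  have "real n * 1 = (\<Sum>i<n. 1)" by simp
  also have "\<dots> \<le> (\<Sum>i<n. \<Sum>j<n. U i j)"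
    using val valid_valuation_sum_ge_1 by (intro sum_mono) auto
  also have "\<dots> \<le> real n * E"
    using rp_value_ge_average[of "{..<n}" "{..<n}" U] assms(2) by (simp add: E field_simps)
  finally show E1: "1 \<le> E" using assms(2) by simp
  have "opt_welfare n U \<in> welfare n U ` outcomes n"
    unfolding opt_welfare_def using finite_outcomes[of n] id_in_outcomes[of n] by (intro Max_in) auto
  then obtain \<mu> where \<mu>: "\<mu> permutes {..<n}" "opt_welfare n U = welfare n U \<mu>"
    by (auto simp: outcomes_def)
  have "{i \<in> {..<n}. \<mu> i \<in> {..<n}} = {..<n}" using permutes_in_image[OF \<mu>(1)] by auto
  then have "(welfare n U \<mu>)\<^sup>2 / (4 * n) \<le> E"
    using rp_value_ge_square[of "{..<n}" "{..<n}" n \<mu> U] profiles_bounds[OF assms(1)]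
      permutes_inj_on[OF \<mu>(1)]
    by (simp add: E welfare_def)
  then have "(opt_welfare n U)\<^sup>2 \<le> 4 * n * E"
    using assms(2) by (simp add: \<mu>(2) field_simps)
  \<comment> \<open>\<open>1 \<le> E\<close> trades \<open>E\<close> for \<open>E * E\<close>, so
    that both sides are squares.\<close>
  also have "\<dots> \<le> 4 * n * (E * E)" using E1 by (intro mult_left_mono) auto
  also have "\<dots> = (2 * sqrt n * E)\<^sup>2" by (simp add: power_mult_distrib power2_eq_square)
  finally show "opt_welfare n U \<le> 2 * sqrt n * E"
    by (rule power2_le_imp_le) (use E1 in auto)
qed

lemma random_priority_approx_ratio_ge:
  assumes "profiles nm n \<noteq> {}" "n > 0"
  shows "(1 / 2) / sqrt n \<le> approx_ratio nm n (random_priority n)"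
  unfolding approx_ratio_def
proof (rule cINF_greatest[OF assms(1)])
  fix U assume U: "U \<in> profiles nm n"
  let ?E = "measure_pmf.expectation (random_priority n U) (welfare n U)"
  have "1 \<le> opt_welfare n U"
    using random_priority_welfare_ge_1[OF U assms(2)]
      expectation_le_opt[OF is_mechanism_random_priority U] by simp
  moreover have "opt_welfare n U \<le> 2 * sqrt n * ?E"
    by (rule random_priority_welfare_ge_opt[OF U assms(2)])
  ultimately show "(1 / 2) / sqrt n \<le> ?E / opt_welfare n U"
    using assms(2) by (simp add: field_simps)
qed

section \<open>Planting special agents\<close>

text \<open>Double counting of the pairs \<open>(T, i)\<close> through \<open>T - {i}\<close>: every \<open>T - {i}\<close> arises from at least
  \<open>D\<close> pairs, so there are at most \<open>k * card \<T> / D\<close> of these sets.\<close>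

lemma exists_low_sum:
  fixes p h :: "'a set \<Rightarrow> 'a \<Rightarrow> real" and B D :: real and k :: nat
  assumes fin: "finite \<T>" and ne: "\<T> \<noteq> {}"
    and card: "\<And>T. T \<in> \<T> \<Longrightarrow> finite T \<and> card T = k"
    and p: "\<And>T i. T \<in> \<T> \<Longrightarrow> i \<in> T \<Longrightarrow> p T i \<le> h (T - {i}) i"
    and D: "\<And>T i. T \<in> \<T> \<Longrightarrow> i \<in> T \<Longrightarrow> D \<le> card {j. j \<notin> T - {i} \<and> insert j (T - {i}) \<in> \<T>}"
    and B: "\<And>T i. T \<in> \<T> \<Longrightarrow> i \<in> T \<Longrightarrow>
              (\<Sum>j | j \<notin> T - {i} \<and> insert j (T - {i}) \<in> \<T>. h (T - {i}) j) \<le> B"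
    and "D > 0" "B \<ge> 0"
  shows "\<exists>T\<in>\<T>. (\<Sum>i\<in>T. p T i) \<le> k * B / D"
proof (rule ccontr)
  assume neg: "\<not> ?thesis"
  define Ext where "Ext = (\<lambda>S. {j. j \<notin> S \<and> insert j S \<in> \<T>})"
  define \<S> where "\<S> = (\<lambda>(T, i). T - {i}) ` (SIGMA T:\<T>. T)"
  have fin\<S>: "finite \<S>"
    unfolding \<S>_def using fin card by (intro finite_imageI finite_SigmaI) auto
  have "Ext S \<subseteq> \<Union>\<T>" for S by (auto simp: Ext_def)
  moreover have "finite (\<Union>\<T>)" using fin card by auto
  ultimately have finExt: "finite (Ext S)" for S by (rule finite_subset)
  have swap: "(\<Sum>T\<in>\<T>. \<Sum>i\<in>T. F (T - {i}) i) = (\<Sum>S\<in>\<S>. \<Sum>j\<in>Ext S. F S j)" for F :: "'a set \<Rightarrow> 'a \<Rightarrow> real"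
  proof -
    have "(\<Sum>T\<in>\<T>. \<Sum>i\<in>T. F (T - {i}) i) = (\<Sum>(T, i)\<in>(SIGMA T:\<T>. T). F (T - {i}) i)"
      using fin card by (intro sum.Sigma) auto
    also have "\<dots> = (\<Sum>(S, j)\<in>(SIGMA S:\<S>. Ext S). F S j)"
      by (rule sum.reindex_bij_witness[where i = "\<lambda>(S, j). (insert j S, j)" and j = "\<lambda>(T, i). (T - {i}, i)"])
        (force simp: \<S>_def Ext_def insert_absorb)+
    also have "\<dots> = (\<Sum>S\<in>\<S>. \<Sum>j\<in>Ext S. F S j)"
      using fin\<S> finExt by (intro sum.Sigma[symmetric]) auto
    finally show ?thesis .
  qed
  have "D \<le> card (Ext S)" if "S \<in> \<S>" for S
    using that D by (auto simp: \<S>_def Ext_def)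
  then have "card \<S> * D \<le> (\<Sum>S\<in>\<S>. \<Sum>j\<in>Ext S. 1)"
    using sum_bounded_below[of \<S> D "\<lambda>S. real (card (Ext S))"] by simp
  also have "\<dots> = (\<Sum>T\<in>\<T>. \<Sum>i\<in>T. 1)" using swap[of "\<lambda>_ _. 1"] by simp
  also have "\<dots> = k * card \<T>" using card by (simp add: sum_distrib_left mult.commute)
  finally have card\<S>: "card \<S> \<le> k * card \<T> / D" using \<open>D > 0\<close> by (simp add: field_simps)
  \<comment> \<open>If every \<open>T\<close> exceeded \<open>k * B / D\<close>, the total over
    \<open>\<T>\<close> would exceed \<open>card \<T>\<close> times that; regrouping by
    \<open>T - {i}\<close> bounds the total by \<open>card \<S> * B\<close>.\<close>
  have "card \<T> * (k * B / D) = (\<Sum>T\<in>\<T>. k * B / D)" by simp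
  also have "\<dots> < (\<Sum>T\<in>\<T>. \<Sum>i\<in>T. p T i)"
    using neg fin ne by (intro sum_strict_mono) auto
  also have "\<dots> \<le> (\<Sum>T\<in>\<T>. \<Sum>i\<in>T. h (T - {i}) i)" using p by (intro sum_mono) auto
  also have "\<dots> = (\<Sum>S\<in>\<S>. \<Sum>j\<in>Ext S. h S j)" by (rule swap)
  also have "\<dots> \<le> card \<S> * B"
    using B by (intro sum_bounded_above) (auto simp: \<S>_def Ext_def)
  also have "\<dots> \<le> (k * card \<T> / D) * B" using card\<S> \<open>B \<ge> 0\<close> by (rule mult_right_mono)
  finally show False by (simp add: field_simps)
qed

section \<open>Order-preserving misreports and planted profiles\<close>

definition same_order_truthful :: "normalization \<Rightarrow> nat \<Rightarrow> mechanism \<Rightarrow> bool" where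
  "same_order_truthful nm n J \<longleftrightarrow>
     (\<forall>i<n. \<forall>U \<in> profiles nm n. \<forall>v. valid_valuation nm n v \<longrightarrow>
        (\<forall>j<n. \<forall>k<n. U i j < U i k \<longleftrightarrow> v j < v k) \<longrightarrow>
        measure_pmf.expectation (J (U(i := v))) (\<lambda>\<mu>. U i (\<mu> i))
          \<le> measure_pmf.expectation (J U) (\<lambda>\<mu>. U i (\<mu> i)))"

lemma truthful_imp_same_order_truthful:
  "truthful_in_expectation nm n J \<Longrightarrow> same_order_truthful nm n J"
  by (auto simp: truthful_in_expectation_def same_order_truthful_def)

lemma ordinal_imp_same_order_truthful:
  "ordinal_mechanism nm n J \<Longrightarrow> same_order_truthful nm n J"
  by (simp add: ordinal_mechanism_def same_order_truthful_def)

text \<open>Every outcome in the support is a permutation, so the sum over agents is the same for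
  each of them. With \<open>f\<close> the indicator of one item, the chances of all agents for it
  add up to 1.\<close>

lemma sum_expectation_items:
  fixes f :: "nat \<Rightarrow> real"
  assumes "is_mechanism nm n J" "U \<in> profiles nm n"
  shows "(\<Sum>i<n. measure_pmf.expectation (J U) (\<lambda>\<mu>. f (\<mu> i))) = (\<Sum>j<n. f j)"
proof -
  have "(\<Sum>i<n. f (\<mu> i)) = (\<Sum>j<n. f j)" if "\<mu> permutes {..<n}" for \<mu>
    using sum.permute[OF that, of f] by (simp add: o_def)
  then have "measure_pmf.expectation (J U) (\<lambda>\<mu>. \<Sum>i<n. f (\<mu> i))
      = measure_pmf.expectation (J U) (\<lambda>\<mu>. \<Sum>j<n. f j)"
    by (intro antisym expectation_mono_outcomes[OF assms]) auto
  then show ?thesis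
    by (simp add: Bochner_Integration.integral_sum integrable_mechanism[OF assms])
qed

lemma expectation_welfare:
  assumes "is_mechanism nm n J" "U \<in> profiles nm n"
  shows "measure_pmf.expectation (J U) (welfare n U)
    = (\<Sum>i<n. measure_pmf.expectation (J U) (\<lambda>\<mu>. U i (\<mu> i)))"
  unfolding welfare_def
  by (simp add: Bochner_Integration.integral_sum integrable_mechanism[OF assms])

text \<open>The hard profiles: the agents in \<open>T\<close> have valuations \<open>s i\<close> that are concentrated on few
  items, the others report order-equivalent valuations \<open>u i\<close> of low total welfare.\<close>

definition planted_profile :: "nat \<Rightarrow> profile \<Rightarrow> profile \<Rightarrow> nat set \<Rightarrow> profile" where
  "planted_profile n u s T = (\<lambda>i. if i < n then (if i \<in> T then s i else u i) else (\<lambda>_. 0))"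

lemma planted_profile_in_profiles:
  assumes "\<And>i. i < n \<Longrightarrow> valid_valuation nm n (u i)" "\<And>i. i < n \<Longrightarrow> valid_valuation nm n (s i)"
  shows "planted_profile n u s T \<in> profiles nm n"
  using assms by (auto simp: planted_profile_def profiles_def)

text \<open>In the profile planted at \<open>T - {i}\<close> agent \<open>i\<close> truly has
  valuation \<open>u i\<close>; the misreport \<open>s i\<close> turns it into the profile planted
  at \<open>T\<close>.\<close>

lemma planted_profile_no_gain:
  assumes "same_order_truthful nm n J"
    and "\<And>i. i < n \<Longrightarrow> valid_valuation nm n (u i)" "\<And>i. i < n \<Longrightarrow> valid_valuation nm n (s i)"
    and "\<And>j l. j < n \<Longrightarrow> l < n \<Longrightarrow> u i j < u i l \<longleftrightarrow> s i j < s i l"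
    and "i \<in> T" "i < n"
  shows "measure_pmf.expectation (J (planted_profile n u s T)) (\<lambda>\<mu>. u i (\<mu> i))
    \<le> measure_pmf.expectation (J (planted_profile n u s (T - {i}))) (\<lambda>\<mu>. u i (\<mu> i))"
proof -
  let ?U = "planted_profile n u s (T - {i})"
  have "planted_profile n u s T = ?U(i := s i)" "?U i = u i"
    using assms(5,6) by (auto simp: planted_profile_def)
  moreover have "?U \<in> profiles nm n" using assms(2,3) by (rule planted_profile_in_profiles)
  ultimately show ?thesis
    using assms(1) assms(3)[OF \<open>i < n\<close>] assms(4,6) unfolding same_order_truthful_def by metis
qed

text \<open>\<open>f j\<close> caps what item \<open>j\<close> is worth in any hands, apart from a
  bonus of at most 1 that a special agent gets from its desired set \<open>X i\<close>. Each item is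
  handed out once, so \<open>f\<close> contributes its sum, and \<open>low\<close> limits the
  bonuses to \<open>a\<close>. The matching \<open>g\<close> gives every special agent at least
  1/2.\<close>

lemma planted_profile_approx_ratio:
  fixes a :: real and f :: "nat \<Rightarrow> real"
  assumes J: "is_mechanism nm n J"
    and valid: "\<And>i. i < n \<Longrightarrow> valid_valuation nm n (u i)" "\<And>i. i < n \<Longrightarrow> valid_valuation nm n (s i)"
    and u: "\<And>i j. i < n \<Longrightarrow> j < n \<Longrightarrow> u i j \<le> f j"
    and s: "\<And>i j. i < n \<Longrightarrow> j < n \<Longrightarrow> s i j \<le> f j + of_bool (j \<in> X i)"
    and T: "T \<subseteq> {..<n}" and low:
      "(\<Sum>i\<in>T. measure_pmf.expectation (J (planted_profile n u s T)) (\<lambda>\<mu>. of_bool (\<mu> i \<in> X i))) \<le> a"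
    and g: "inj_on g T" "\<And>i. i \<in> T \<Longrightarrow> g i < n" "\<And>i. i \<in> T \<Longrightarrow> 1 / 2 \<le> s i (g i)" and "0 < card T"
  shows "approx_ratio nm n J \<le> ((\<Sum>j<n. f j) + a) / (card T / 2)"
proof (rule approx_ratio_le[OF J])
  let ?U = "planted_profile n u s T"
  let ?E = "measure_pmf.expectation (J ?U)"
  show U: "?U \<in> profiles nm n" using valid by (rule planted_profile_in_profiles)
  note int = integrable_mechanism[OF J U]
  have "?E (\<lambda>\<mu>. ?U i (\<mu> i)) \<le> ?E (\<lambda>\<mu>. f (\<mu> i)) + (if i \<in> T then ?E (\<lambda>\<mu>. of_bool (\<mu> i \<in> X i)) else 0)"
    if i: "i < n" for i
  proof -
    have "?E (\<lambda>\<mu>. ?U i (\<mu> i)) \<le> ?E (\<lambda>\<mu>. f (\<mu> i) + of_bool (i \<in> T) * of_bool (\<mu> i \<in> X i))"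
    proof (rule expectation_mono_outcomes[OF J U])
      fix \<mu> assume "\<mu> permutes {..<n}"
      then have "\<mu> i < n" using i permutes_in_image[of \<mu> "{..<n}" i] by simp
      then show "?U i (\<mu> i) \<le> f (\<mu> i) + of_bool (i \<in> T) * of_bool (\<mu> i \<in> X i)"
        using i u[of i "\<mu> i"] s[of i "\<mu> i"] by (auto simp: planted_profile_def)
    qed
    also have "\<dots> = ?E (\<lambda>\<mu>. f (\<mu> i)) + (if i \<in> T then ?E (\<lambda>\<mu>. of_bool (\<mu> i \<in> X i)) else 0)"
      using int by (subst Bochner_Integration.integral_add) auto
    finally show ?thesis .
  qed
  then have "?E (welfare n ?U) \<le>
      (\<Sum>i<n. ?E (\<lambda>\<mu>. f (\<mu> i)) + (if i \<in> T then ?E (\<lambda>\<mu>. of_bool (\<mu> i \<in> X i)) else 0))"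
    unfolding expectation_welfare[OF J U] by (intro sum_mono) auto
  also have "\<dots> = (\<Sum>j<n. f j) + (\<Sum>i\<in>{..<n} \<inter> T. ?E (\<lambda>\<mu>. of_bool (\<mu> i \<in> X i)))"
    by (simp add: sum.distrib sum_expectation_items[OF J U] sum.inter_restrict)
  also have "{..<n} \<inter> T = T" using T by auto
  finally show "?E (welfare n ?U) \<le> (\<Sum>j<n. f j) + a" using low by simp
  have "card T / 2 = (\<Sum>i\<in>T. 1 / 2)" by simp
  also have "\<dots> \<le> (\<Sum>i\<in>T. ?U i (g i))"
    using g(3) T by (intro sum_mono) (auto simp: planted_profile_def)
  also have "\<dots> \<le> opt_welfare n ?U"
    using profiles_bounds[OF U] T g by (intro opt_welfare_ge_partial) auto
  finally show "card T / 2 \<le> opt_welfare n ?U" .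
qed (use assms in auto)

section \<open>The unit-range normalization\<close>

lemma sum_of_bool_less: "m \<le> n \<Longrightarrow> (\<Sum>j<n. of_bool (j < m) :: real) = real m" for m n :: nat
proof -
  assume "m \<le> n"
  then have "{..<n} \<inter> {j. j < m} = {..<m}" by auto
  then show ?thesis by (simp add: of_bool_def sum.If_cases)
qed

lemma sum_of_bool_eq: "m < n \<Longrightarrow> (\<Sum>j<n. of_bool (j = m) :: real) = 1" for m n :: nat
  by (simp add: of_bool_def)

lemma valid_valuation_UnitRangeI:
  assumes "2 \<le> n" "u 0 = 1" "u (n - 1) = 0" "\<And>j. n \<le> j \<Longrightarrow> u j = 0"
    and decr: "\<And>i j. i < j \<Longrightarrow> j < n \<Longrightarrow> u j < u i"
  shows "valid_valuation UnitRange n u"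
proof -
  have "inj_on u {..<n}"
    by (rule inj_onI) (metis decr lessThan_iff less_irrefl linorder_neqE_nat)
  moreover have "u j \<le> 1" if "j < n" for j using decr[of 0 j] that assms(2) by (cases "j = 0") auto
  then have "Max (u ` {..<n}) = 1"
    using assms(1,2) by (intro Max_eqI) (auto intro: image_eqI[of _ _ 0])
  moreover have "0 \<le> u j" if "j < n" for j
  proof (cases "j < n - 1")
    case True
    then show ?thesis using decr[of j "n - 1"] assms(1,3) by auto
  next
    case False
    then have "j = n - 1" using that by linarith
    then show ?thesis using assms(3) by simp
  qed
  then have "Min (u ` {..<n}) = 0"
    using assms(1,3) by (intro Min_eqI) (auto intro: image_eqI[of _ _ "n - 1"])
  ultimately show ?thesis using assms(1,4) by (auto simp: valid_valuation_def)
qed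

lemma decreasing_less_iff:
  fixes u v :: valuation
  assumes "\<And>i j. i < j \<Longrightarrow> j < n \<Longrightarrow> u j < u i" "\<And>i j. i < j \<Longrightarrow> j < n \<Longrightarrow> v j < v i" "j < n" "l < n"
  shows "u j < u l \<longleftrightarrow> v j < v l"
  using assms by (metis less_asym linorder_neqE_nat less_irrefl)

text \<open>Item \<open>0\<close> is everybody's favourite and the items below \<open>k\<close> are the desired ones. A flat
  agent values them at \<open>1/k\<close>, so only a larger chance of item \<open>0\<close>, which exists just once, can
  compensate it for not posing as special. The tilt breaks ties.\<close>

definition tilt :: "nat \<Rightarrow> nat \<Rightarrow> real" where
  "tilt n j = (real n - 1 - j) / n\<^sup>2"

definition range_flat :: "nat \<Rightarrow> nat \<Rightarrow> valuation" where
  "range_flat n k j = (if n \<le> j then 0 else if j = 0 then 1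
     else tilt n j + (if j < k then 1 / k else 0))"

definition range_special :: "nat \<Rightarrow> nat \<Rightarrow> valuation" where
  "range_special n k j = (if n \<le> j then 0 else if j < k then 1 - j / (2 * n) else tilt n j)"

section \<open>Unit range: order and bounds of the hard valuations, and the ratio\<close>

context
  fixes n k :: nat
  assumes n: "2 \<le> n" and k: "1 \<le> k" "k * k \<le> n"
begin

lemma tilt_bounds:
  assumes "j < n"
  shows "0 \<le> tilt n j" "tilt n j < 1 / n"
proof -
  show "0 \<le> tilt n j" unfolding tilt_def using assms by (intro divide_nonneg_nonneg) auto
  have "tilt n j < real n / n\<^sup>2" unfolding tilt_def using n by (intro divide_strict_right_mono) auto
  then show "tilt n j < 1 / n" using n by (simp add: power2_eq_square)
qed

lemma tilt_decreasing: "i < j \<Longrightarrow> tilt n j < tilt n i"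
  unfolding tilt_def using n by (intro divide_strict_right_mono) auto

lemma inverse_n_le_half: "1 / real n \<le> 1 / 2"
  using n by (simp add: field_simps)

lemma square_le_imp_less: "k < n"
proof (cases "k = 1")
  case False
  then have "2 * k \<le> k * k" using k by (intro mult_right_mono) auto
  then show ?thesis using k by linarith
qed (use n in auto)

lemma range_flat_decreasing:
  assumes "i < j" "j < n"
  shows "range_flat n k j < range_flat n k i"
proof (cases "i = 0")
  case True
  \<comment> \<open>\<open>j\<close> exceeds \<open>i = 0\<close>, so \<open>j < k\<close> forces
    \<open>k\<close> to be at least 2.\<close>
  have "(if j < k then 1 / k else 0) \<le> 1 / (2::real)"
    using assms(1) by (auto simp: field_simps)
  moreover have "range_flat n k j = tilt n j + (if j < k then 1 / k else 0)" "range_flat n k i = 1"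
    using True assms by (auto simp: range_flat_def)
  ultimately show ?thesis
    using tilt_bounds(2)[OF assms(2)] inverse_n_le_half by linarith
next
  case False
  have "(if j < k then 1 / k else 0) \<le> (if i < k then 1 / k else 0 :: real)" using assms by auto
  then show ?thesis using False assms tilt_decreasing[OF assms(1)] by (simp add: range_flat_def)
qed

lemma range_special_decreasing:
  assumes "i < j" "j < n"
  shows "range_special n k j < range_special n k i"
proof (cases "i < k \<and> k \<le> j")
  case True
  \<comment> \<open>Desired items stay above 1/2, and all later ones are below
    \<open>1 / n \<le> 1 / 2\<close>.\<close>
  have "real i / (2 * n) < 1 / 2" using assms n by (simp add: field_simps)
  moreover have "range_special n k j = tilt n j" "range_special n k i = 1 - i / (2 * n)"
    using True assms by (auto simp: range_special_def)
  ultimately show ?thesis using tilt_bounds(2)[OF assms(2)] inverse_n_le_half by linarith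
next
  case False
  have "real i / (2 * n) < real j / (2 * n)" using assms n by (intro divide_strict_right_mono) auto
  then show ?thesis
    using False assms tilt_decreasing[OF assms(1)] by (auto simp: range_special_def)
qed

lemma range_valid:
  "valid_valuation UnitRange n (range_flat n k)" "valid_valuation UnitRange n (range_special n k)"
proof -
  have "n - 1 \<noteq> 0" "n - 1 < n" "k \<le> n - 1" using n square_le_imp_less by auto
  then show "valid_valuation UnitRange n (range_flat n k)" "valid_valuation UnitRange n (range_special n k)"
    using n k by (auto intro!: valid_valuation_UnitRangeI range_flat_decreasing range_special_decreasing)
      (auto simp: range_flat_def range_special_def tilt_def)
qed

lemma range_flat_lower: "j < n \<Longrightarrow> of_bool (j < k) / k \<le> range_flat n k j"
  using tilt_bounds[of j] k by (auto simp: range_flat_def)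

lemma range_flat_upper: "j < n \<Longrightarrow> range_flat n k j \<le> of_bool (j = 0) + of_bool (j < k) / k + 1 / n"
  using tilt_bounds[of j] by (auto simp: range_flat_def)

lemma range_special_upper:
  "j < n \<Longrightarrow> range_special n k j \<le> of_bool (j = 0) + of_bool (j < k) / k + 1 / n + of_bool (j < k)"
  using tilt_bounds[of j] by (auto simp: range_special_def intro: order_trans[of _ 0])

lemma range_special_lower: "j < k \<Longrightarrow> 1 / 2 \<le> range_special n k j"
  using square_le_imp_less by (auto simp: range_special_def field_simps)

lemma sum_range_upper: "(\<Sum>j<n. of_bool (j = 0) + of_bool (j < k) / k + 1 / real n) = 3"
  using n k square_le_imp_less sum_of_bool_eq[of 0] sum_of_bool_less[of k]
  by (simp add: sum.distrib flip: sum_divide_distrib)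

text \<open>Every \<open>k\<close>-subset of agents may be special. The chance \<open>q\<close> of a
  desired item exceeds the one the agent has when flat by at most \<open>k * r + k / n\<close>,
  where \<open>r\<close> is the flat agent's chance of item \<open>0\<close>. Summed over all agents
  the bound \<open>h\<close> is only \<open>3 * k\<close>, so some \<open>T\<close> leaves a total
  chance of at most 6.\<close>

lemma range_approx_ratio:
  assumes J: "is_mechanism UnitRange n J" "same_order_truthful UnitRange n J"
  shows "approx_ratio UnitRange n J \<le> 18 / k"
proof -
  define P where "P = planted_profile n (\<lambda>_. range_flat n k) (\<lambda>_. range_special n k)"
  define E :: "nat set \<Rightarrow> (outcome \<Rightarrow> real) \<Rightarrow> real" where "E = (\<lambda>T. measure_pmf.expectation (J (P T)))"
  define q where "q = (\<lambda>T i. E T (\<lambda>\<mu>. of_bool (\<mu> i < k)) :: real)"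
  define r where "r = (\<lambda>T i. E T (\<lambda>\<mu>. of_bool (\<mu> i = 0)) :: real)"
  define h where "h = (\<lambda>T i. q T i + k * r T i + k / n)"
  have P: "P T \<in> profiles UnitRange n" for T
    unfolding P_def by (intro planted_profile_in_profiles range_valid)
  note int = integrable_mechanism[OF J(1) P]
  note mono = expectation_mono_outcomes[OF J(1) P]
  have in_n: "\<mu> i < n" if "\<mu> permutes {..<n}" "i < n" for \<mu> i
    using that permutes_in_image[of \<mu> "{..<n}" i] by simp
  have q_le: "q T i \<le> h (T - {i}) i" if i: "i \<in> T" "i < n" for T i
  proof -
    have "q T i / k = E T (\<lambda>\<mu>. of_bool (\<mu> i < k) / k)"
      by (simp add: q_def E_def)
    also have "\<dots> \<le> E T (\<lambda>\<mu>. range_flat n k (\<mu> i))"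
      unfolding E_def using in_n[OF _ i(2)] by (intro mono range_flat_lower)
    also have "\<dots> \<le> E (T - {i}) (\<lambda>\<mu>. range_flat n k (\<mu> i))"
      unfolding E_def P_def
      using J(2) range_valid i
      by (intro planted_profile_no_gain decreasing_less_iff range_flat_decreasing range_special_decreasing)
    also have "\<dots> \<le> E (T - {i}) (\<lambda>\<mu>. of_bool (\<mu> i = 0) + of_bool (\<mu> i < k) / k + 1 / n)"
      unfolding E_def using in_n[OF _ i(2)] by (intro mono range_flat_upper)
    also have "\<dots> = r (T - {i}) i + q (T - {i}) i / k + 1 / n"
      unfolding E_def q_def r_def using int by simp
    finally show ?thesis using k by (simp add: h_def field_simps)
  qed
  \<comment> \<open>Each summand of \<open>h\<close> contributes \<open>k\<close>: there are
    \<open>k\<close> desired items, item \<open>0\<close> exists once and has weight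
    \<open>k\<close>, and \<open>k / n\<close> occurs \<open>n\<close> times.\<close>
  have sum_h: "(\<Sum>i<n. h S i) = 3 * k" for S
  proof -
    have "(\<Sum>i<n. q S i) = k" "(\<Sum>i<n. r S i) = 1"
      unfolding q_def r_def E_def
      using sum_expectation_items[OF J(1) P, of S "\<lambda>j. of_bool (j < k)"]
        sum_expectation_items[OF J(1) P, of S "\<lambda>j. of_bool (j = 0)"]
        sum_of_bool_less[of k] sum_of_bool_eq[of 0] square_le_imp_less n by simp_all
    then show ?thesis using n by (simp add: h_def sum.distrib flip: sum_distrib_left)
  qed
  have h0: "0 \<le> h S i" for S i
    by (auto simp: h_def q_def r_def E_def intro!: add_nonneg_nonneg mult_nonneg_nonneg)
  define \<T> where "\<T> = {T. T \<subseteq> {..<n} \<and> card T = k}"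
  have fin: "finite \<T>" unfolding \<T>_def by (rule finite_subset[of _ "Pow {..<n}"]) auto
  have ne: "\<T> \<noteq> {}" using square_le_imp_less by (auto simp: \<T>_def intro!: exI[of _ "{..<k}"])
  have finT: "finite T \<and> card T = k" if "T \<in> \<T>" for T using that finite_subset[of T "{..<n}"] by (auto simp: \<T>_def)
  \<comment> \<open>Any of the \<open>n - k + 1\<close> agents outside \<open>T - {i}\<close>,
    including \<open>i\<close>, completes it to a \<open>k\<close>-set.\<close>
  have Ext: "{j. j \<notin> T - {i} \<and> insert j (T - {i}) \<in> \<T>} = {..<n} - (T - {i})"
    if "T \<in> \<T>" "i \<in> T" for T i
    using that finT[OF that(1)] k by (auto simp: \<T>_def card_insert_if)
  have "\<exists>T\<in>\<T>. (\<Sum>i\<in>T. q T i) \<le> real k * (3 * real k) / (real n - k + 1)"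
  proof (rule exists_low_sum[OF fin ne finT])
    fix T i assume T: "T \<in> \<T>" "i \<in> T"
    have "card ({..<n} - (T - {i})) = n - (k - 1)"
      using T finT[OF T(1)] by (subst card_Diff_subset) (auto simp: \<T>_def)
    then show "real n - k + 1 \<le> card {j. j \<notin> T - {i} \<and> insert j (T - {i}) \<in> \<T>}"
      unfolding Ext[OF T] using square_le_imp_less k by (simp add: of_nat_diff)
    show "(\<Sum>j | j \<notin> T - {i} \<and> insert j (T - {i}) \<in> \<T>. h (T - {i}) j) \<le> 3 * real k"
    proof -
      have "(\<Sum>j\<in>{..<n} - (T - {i}). h (T - {i}) j) \<le> (\<Sum>j<n. h (T - {i}) j)"
        using h0 by (intro sum_mono2) auto
      then show ?thesis unfolding Ext[OF T] sum_h by simp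
    qed
    show "q T i \<le> h (T - {i}) i" using T by (intro q_le) (auto simp: \<T>_def)
  qed (use square_le_imp_less in auto)
  then obtain T where T: "T \<subseteq> {..<n}" "card T = k" "(\<Sum>i\<in>T. q T i) \<le> real k * (3 * real k) / (real n - k + 1)"
    by (auto simp: \<T>_def)
  \<comment> \<open>Clearing the denominator leaves \<open>k^2 \<le> 2*n - 2*k + 2\<close>, which
    follows from \<open>k^2 \<le> n\<close> and \<open>2*k \<le> k^2 + 1\<close>.\<close>
  have "real k * (3 * real k) / (real n - k + 1) \<le> 6"
  proof -
    have "2 * real k \<le> real k * real k + 1"
      using zero_le_power2[of "real k - 1"] by (simp add: power2_eq_square algebra_simps)
    moreover have "real k * real k \<le> real n" using k(2) by (simp flip: of_nat_mult)
    ultimately show ?thesis using square_le_imp_less by (simp add: field_simps)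
  qed
  then have low: "(\<Sum>i\<in>T. q T i) \<le> 6" using T(3) by linarith
  obtain g where g: "bij_betw g T {..<k}"
    using finite_same_card_bij[of T "{..<k}"] T finite_subset[OF T(1)] by auto
  have "approx_ratio UnitRange n J
      \<le> ((\<Sum>j<n. of_bool (j = 0) + of_bool (j < k) / k + 1 / real n) + 6) / (card T / 2)"
  proof (rule planted_profile_approx_ratio[where X = "\<lambda>_. {..<k}" and g = g, OF J(1)])
    show "(\<Sum>i\<in>T. measure_pmf.expectation (J (planted_profile n (\<lambda>_. range_flat n k)
        (\<lambda>_. range_special n k) T)) (\<lambda>\<mu>. of_bool (\<mu> i \<in> {..<k}))) \<le> (6::real)"
      using low by (simp add: q_def E_def P_def)
    show "inj_on g T" using g by (simp add: bij_betw_def)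
    have "g i < k" if "i \<in> T" for i using g that by (auto simp: bij_betw_def)
    then show "\<And>i. i \<in> T \<Longrightarrow> g i < n" "\<And>i. i \<in> T \<Longrightarrow> 1 / 2 \<le> range_special n k (g i)"
      using square_le_imp_less range_special_lower by (auto intro: less_trans)
  qed (use T k range_valid range_flat_upper range_special_upper in auto)
  then show ?thesis using sum_range_upper T(2) by simp
qed

end

section \<open>The unit-sum normalization\<close>

text \<open>A valuation with a single peak at \<open>g\<close> over an almost constant base \<open>c\<close>; the summand \<open>j / n ^ 3\<close>
  breaks ties. Special agents have base \<open>0\<close>, flat agents have a base such that the peak is
  about \<open>1/k\<close>.\<close>

definition sum_peak :: "nat \<Rightarrow> real \<Rightarrow> real" where
  "sum_peak n c = 1 - n * c - (\<Sum>j<n. real j / real n ^ 3)"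

definition sum_valuation :: "nat \<Rightarrow> real \<Rightarrow> nat \<Rightarrow> valuation" where
  "sum_valuation n c g j =
     (if n \<le> j then 0 else c + real j / real n ^ 3 + (if j = g then sum_peak n c else 0))"

lemma sum_tilt_bounds:
  assumes "1 \<le> n"
  shows "0 \<le> (\<Sum>j<n. real j / real n ^ 3)" "(\<Sum>j<n. real j / real n ^ 3) \<le> 1 / (2 * real n)"
proof -
  show "0 \<le> (\<Sum>j<n. real j / real n ^ 3)" by (intro sum_nonneg) auto
  have "(\<Sum>j<n. real j) = real n * (real n - 1) / 2"
    by (induction n) (auto simp: field_simps)
  then have "(\<Sum>j<n. real j / real n ^ 3) = real n * (real n - 1) / 2 / real n ^ 3"
    by (simp only: sum_divide_distrib[symmetric])
  also have "\<dots> = (real n - 1) / (2 * real n ^ 2)"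
    using assms by (simp add: power2_eq_square power3_eq_cube)
  also have "\<dots> \<le> real n / (2 * real n ^ 2)" by (intro divide_right_mono) auto
  also have "\<dots> = 1 / (2 * real n)" using assms by (simp add: power2_eq_square)
  finally show "(\<Sum>j<n. real j / real n ^ 3) \<le> 1 / (2 * real n)" .
qed

text \<open>The peak beats every tie-breaking summand: these are at most
  \<open>(n - 1) / n^3 < 1 / (2 * n)\<close>. So \<open>g\<close> comes out on top and the other
  items are ranked by index; as \<open>c\<close> does not influence this, different bases are
  order-equivalent.\<close>

lemma sum_valuation_less_iff:
  assumes peak: "1 / (2 * real n) \<le> sum_peak n c" and "g < n" "a < n" "b < n"
  shows "sum_valuation n c g a < sum_valuation n c g b \<longleftrightarrow> a \<noteq> g \<and> (b = g \<or> a < b)"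
proof -
  have n: "1 \<le> n" using assms by auto
  have tilt: "real j / real n ^ 3 < sum_peak n c" if "j < n" for j
  proof -
    have "0 < (real n - 1)\<^sup>2 + 1" by (simp add: add_nonneg_pos)
    then have "2 * (real n - 1) < real n ^ 2" by (simp add: power2_eq_square algebra_simps)
    have "real j / real n ^ 3 \<le> (real n - 1) / real n ^ 3" using that by (intro divide_right_mono) auto
    also have "\<dots> < (real n ^ 2 / 2) / real n ^ 3"
      using \<open>2 * (real n - 1) < real n ^ 2\<close> n by (intro divide_strict_right_mono) auto
    also have "\<dots> = 1 / (2 * real n)" using n by (simp add: power2_eq_square power3_eq_cube)
    finally show ?thesis using peak by simp
  qed
  define x y where "x = real a / real n ^ 3" and "y = real b / real n ^ 3"
  have "x < y \<longleftrightarrow> a < b"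
    using n by (simp add: x_def y_def divide_less_cancel)
  moreover have "0 \<le> x" "0 \<le> y" "x < sum_peak n c" "y < sum_peak n c"
    using tilt assms(3,4) by (auto simp: x_def y_def)
  moreover have "sum_valuation n c g a = c + x + (if a = g then sum_peak n c else 0)"
    "sum_valuation n c g b = c + y + (if b = g then sum_peak n c else 0)"
    using assms(3,4) by (auto simp: sum_valuation_def x_def y_def)
  ultimately show ?thesis by auto
qed

lemma sum_valuation_valid:
  assumes peak: "1 / (2 * real n) \<le> sum_peak n c" and "g < n" "0 \<le> c"
  shows "valid_valuation UnitSum n (sum_valuation n c g)"
proof -
  have "inj_on (sum_valuation n c g) {..<n}"
  proof (rule inj_onI)
    fix a b assume ab: "a \<in> {..<n}" "b \<in> {..<n}" and eq: "sum_valuation n c g a = sum_valuation n c g b"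
    have "\<not> (a \<noteq> g \<and> (b = g \<or> a < b))" "\<not> (b \<noteq> g \<and> (a = g \<or> b < a))"
      using ab eq sum_valuation_less_iff[OF peak assms(2), of a b]
        sum_valuation_less_iff[OF peak assms(2), of b a] by auto
    then show "a = b" by auto
  qed
  moreover have "0 \<le> sum_peak n c" using peak by (rule order_trans[rotated]) simp
  then have "0 \<le> sum_valuation n c g j" for j
    using assms(3) by (auto simp: sum_valuation_def)
  moreover have "(\<Sum>j<n. sum_valuation n c g j) = (\<Sum>j<n. c + real j / real n ^ 3 + (if j = g then sum_peak n c else 0))"
    by (intro sum.cong) (auto simp: sum_valuation_def)
  then have "(\<Sum>j<n. sum_valuation n c g j) = 1"
    using assms(2) by (simp add: sum.distrib sum_peak_def)
  moreover have "sum_valuation n c g j = 0" if "n \<le> j" for j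
    using that by (simp add: sum_valuation_def)
  ultimately show ?thesis by (simp add: valid_valuation_def)
qed

section \<open>Unit sum: desired items by residue class, and the ratio\<close>

context
  fixes n k :: nat
  assumes k: "1 \<le> k" "k * k \<le> n"
begin

text \<open>Agents are split into \<open>k\<close> classes by residue, and class \<open>g\<close>
  desires item \<open>g\<close> only. A total base of \<open>1 - 1 / k\<close> leaves
  \<open>1 / k\<close> for the peak, up to the tie-breaking terms.\<close>

definition sum_flat :: "nat \<Rightarrow> valuation" where
  "sum_flat i = sum_valuation n ((1 - 1 / k) / n) (i mod k)"

definition sum_special :: "nat \<Rightarrow> valuation" where
  "sum_special i = sum_valuation n 0 (i mod k)"

lemma square_le_imp_le: "k \<le> n"
  using k le_square[of k] by linarith

lemma n_pos: "1 \<le> n"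
  using k square_le_imp_le by simp

lemma mod_root_less: "i mod k < k" "i mod k < n"
proof -
  show "i mod k < k" using k by simp
  then show "i mod k < n" using square_le_imp_le by (rule less_le_trans)
qed

lemma half_inverse_bounds: "1 / (2 * real n) \<le> 1 / (2 * real k)" "1 / (2 * real n) \<le> 1 / 2"
  using k square_le_imp_le by (auto simp: field_simps)

lemma sum_peak_special: "1 / 2 \<le> sum_peak n 0" "sum_peak n 0 \<le> 1" "1 / (2 * real n) \<le> sum_peak n 0"
  using sum_tilt_bounds[OF n_pos] half_inverse_bounds by (simp_all add: sum_peak_def)

lemma sum_peak_flat:
  defines "c \<equiv> (1 - 1 / k) / n"
  shows "1 / (2 * real k) \<le> sum_peak n c" "sum_peak n c \<le> 1 / k" "1 / (2 * real n) \<le> sum_peak n c"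
proof -
  have "n * c = 1 - 1 / k" using n_pos by (simp add: c_def)
  then have "sum_peak n c = 1 / k - (\<Sum>j<n. real j / real n ^ 3)" by (simp add: sum_peak_def)
  \<comment> \<open>The tie-breaking terms total at most
    \<open>1 / (2 * n) \<le> 1 / (2 * k)\<close>, so at least half of \<open>1 / k\<close>
    survives.\<close>
  moreover have "1 / real k = 1 / (2 * real k) + 1 / (2 * real k)" by (simp add: field_simps)
  ultimately show "1 / (2 * real k) \<le> sum_peak n c" "sum_peak n c \<le> 1 / k" "1 / (2 * real n) \<le> sum_peak n c"
    using sum_tilt_bounds[OF n_pos] half_inverse_bounds by linarith+
qed

lemma sum_flat_base: "0 \<le> (1 - 1 / k) / n" "(1 - 1 / k) / n \<le> 1 / n"
  using k n_pos by (auto simp: divide_simps)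

lemma sum_valid:
  "valid_valuation UnitSum n (sum_flat i)" "valid_valuation UnitSum n (sum_special i)"
  unfolding sum_flat_def sum_special_def
  by (rule sum_valuation_valid[OF sum_peak_flat(3) mod_root_less(2) sum_flat_base(1)],
      rule sum_valuation_valid[OF sum_peak_special(3) mod_root_less(2) order_refl])

lemma sum_same_order:
  "j < n \<Longrightarrow> l < n \<Longrightarrow> sum_flat i j < sum_flat i l \<longleftrightarrow> sum_special i j < sum_special i l"
  unfolding sum_flat_def sum_special_def
  by (simp only: sum_valuation_less_iff[OF sum_peak_flat(3) mod_root_less(2)]
      sum_valuation_less_iff[OF sum_peak_special(3) mod_root_less(2)])

lemma sum_tilt_le: "j < n \<Longrightarrow> real j / real n ^ 3 \<le> 1 / (real n)\<^sup>2" "1 / (real n)\<^sup>2 \<le> 1 / n"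
proof -
  assume "j < n"
  then have "real j / real n ^ 3 \<le> real n / real n ^ 3" by (intro divide_right_mono) auto
  then show "real j / real n ^ 3 \<le> 1 / (real n)\<^sup>2" using n_pos by (simp add: power2_eq_square power3_eq_cube)
next
  show "1 / (real n)\<^sup>2 \<le> 1 / n" using n_pos by (simp add: divide_simps power2_eq_square)
qed

lemma sum_flat_bounds:
  defines "c \<equiv> (1 - 1 / k) / n"
  assumes "j < n"
  shows "c + sum_peak n c * of_bool (j = i mod k) \<le> sum_flat i j"
    "sum_flat i j \<le> c + 1 / (real n)\<^sup>2 + sum_peak n c * of_bool (j = i mod k)"
  using assms(2) sum_tilt_le(1)[OF assms(2)] by (auto simp: sum_flat_def sum_valuation_def c_def)

lemma sum_flat_upper:
  assumes "j < n"
  shows "sum_flat i j \<le> 2 / n + of_bool (j < k) / k"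
proof -
  have "sum_peak n ((1 - 1 / k) / n) * of_bool (j = i mod k) \<le> of_bool (j < k) / k"
    using sum_peak_flat(2) mod_root_less(1)[of i] by auto
  then show ?thesis
    using sum_flat_bounds(2)[OF assms, of i] sum_flat_base(2) sum_tilt_le(2) by linarith
qed

lemma sum_special_upper:
  assumes "j < n"
  shows "sum_special i j \<le> 2 / n + of_bool (j < k) / k + of_bool (j \<in> {i mod k})"
proof -
  have "0 \<le> of_bool (j < k) / real k" "0 \<le> 1 / real n" by auto
  moreover have "sum_special i j \<le> 1 / n + of_bool (j \<in> {i mod k})"
    using assms sum_tilt_le(1)[OF assms] sum_tilt_le(2) sum_peak_special(2)
    by (auto simp: sum_special_def sum_valuation_def intro: order_trans)
  ultimately show ?thesis by linarith
qed

lemma sum_special_peak: "1 / 2 \<le> sum_special i (i mod k)"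
  using sum_peak_special(1) mod_root_less(2)[of i]
  by (auto simp: sum_special_def sum_valuation_def intro: add_increasing)

text \<open>The indices \<open>g + m * k\<close> with \<open>m < k\<close> all lie below
  \<open>k * k \<le> n\<close>. They are the \<open>k\<close> interchangeable agents that the double
  counting requires.\<close>

lemma card_residue_class:
  assumes "g < k"
  shows "k \<le> card {j. j < n \<and> j mod k = g}"
proof -
  have "(\<lambda>m. g + m * k) ` {..<k} \<subseteq> {j. j < n \<and> j mod k = g}"
  proof (clarsimp simp: assms)
    fix m assume "m < k"
    then have "Suc m * k \<le> k * k" by (intro mult_right_mono) auto
    then show "g + m * k < n" using assms k by simp
  qed
  then have "card ((\<lambda>m. g + m * k) ` {..<k}) \<le> card {j. j < n \<and> j mod k = g}"
    by (intro card_mono) auto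
  moreover have "inj_on (\<lambda>m. g + m * k) {..<k}" using k by (auto simp: inj_on_def)
  ultimately show ?thesis by (simp add: card_image)
qed

text \<open>The special set \<open>T\<close> has one agent per residue class, so its members desire
  distinct items. A member is replaced only within its class, where at least \<open>k\<close> agents
  compete for a single item; hence for some \<open>T\<close> the chances total at most 3.\<close>

lemma sum_approx_ratio:
  assumes J: "is_mechanism UnitSum n J" "same_order_truthful UnitSum n J"
  shows "approx_ratio UnitSum n J \<le> 12 / k"
proof -
  define P where "P = planted_profile n sum_flat sum_special"
  define E :: "nat set \<Rightarrow> (outcome \<Rightarrow> real) \<Rightarrow> real" where "E = (\<lambda>T. measure_pmf.expectation (J (P T)))"
  define q where "q = (\<lambda>T i. E T (\<lambda>\<mu>. of_bool (\<mu> i = i mod k)))"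
  define h where "h = (\<lambda>T i. q T i + 2 * k / (real n)\<^sup>2)"
  have P: "P T \<in> profiles UnitSum n" for T
    unfolding P_def by (intro planted_profile_in_profiles sum_valid)
  note int = integrable_mechanism[OF J(1) P]
  note mono = expectation_mono_outcomes[OF J(1) P]
  have in_n: "\<mu> i < n" if "\<mu> permutes {..<n}" "i < n" for \<mu> i
    using that permutes_in_image[of \<mu> "{..<n}" i] by simp
  have q_le: "q T i \<le> h (T - {i}) i" if i: "i \<in> T" "i < n" for T i
  proof -
    define c where "c = (1 - 1 / k) / n"
    define G where "G = sum_peak n c"
    \<comment> \<open>An agent always gets exactly one item, so the base \<open>c\<close> has weight
      1 on both sides and cancels.\<close>
    have "c + G * q T i = E T (\<lambda>\<mu>. c + G * of_bool (\<mu> i = i mod k))"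
      unfolding q_def E_def using int by simp
    also have "\<dots> \<le> E T (\<lambda>\<mu>. sum_flat i (\<mu> i))"
      unfolding E_def c_def G_def using in_n[OF _ i(2)] by (intro mono sum_flat_bounds(1))
    also have "\<dots> \<le> E (T - {i}) (\<lambda>\<mu>. sum_flat i (\<mu> i))"
      unfolding E_def P_def
      using J(2) sum_valid i by (intro planted_profile_no_gain sum_same_order)
    also have "\<dots> \<le> E (T - {i}) (\<lambda>\<mu>. c + 1 / (real n)\<^sup>2 + G * of_bool (\<mu> i = i mod k))"
      unfolding E_def c_def G_def using in_n[OF _ i(2)] by (intro mono sum_flat_bounds(2))
    also have "\<dots> = c + 1 / (real n)\<^sup>2 + G * q (T - {i}) i"
      unfolding q_def E_def using int by simp
    finally have "G * (q T i - q (T - {i}) i) \<le> 1 / (real n)\<^sup>2" by (simp add: algebra_simps)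
    note gain = this
    have G: "1 / (2 * real k) \<le> G" unfolding G_def c_def by (rule sum_peak_flat(1))
    have "0 < 1 / (2 * real k)" using k by simp
    then have G0: "0 < G" using G by (rule less_le_trans)
    \<comment> \<open>Dividing by a peak of at least \<open>1 / (2 * k)\<close> produces the error
      \<open>2 * k / n^2\<close> in \<open>h\<close>.\<close>
    have "q T i - q (T - {i}) i \<le> 1 / (real n)\<^sup>2 / G" using G0 gain by (subst pos_le_divide_eq) (simp_all add: mult.commute)
    also have "\<dots> \<le> 1 / (real n)\<^sup>2 / (1 / (2 * real k))"
      using G G0 k by (intro divide_left_mono mult_pos_pos) auto
    finally show ?thesis by (simp add: h_def)
  qed
  define \<T> where "\<T> = {T. T \<subseteq> {..<n} \<and> bij_betw (\<lambda>i. i mod k) T {..<k}}"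
  have fin: "finite \<T>" unfolding \<T>_def by (rule finite_subset[of _ "Pow {..<n}"]) auto
  have "bij_betw (\<lambda>i. i mod k) {..<k} {..<k}"
    by (subst bij_betw_cong[where g = id]) (auto simp: bij_betw_id)
  then have ne: "\<T> \<noteq> {}" using square_le_imp_le by (auto simp: \<T>_def intro!: exI[of _ "{..<k}"])
  have finT: "finite T \<and> card T = k" if "T \<in> \<T>" for T
    using that finite_subset[of T "{..<n}"] bij_betw_same_card[of "\<lambda>i. i mod k" T "{..<k}"]
    by (auto simp: \<T>_def)
  \<comment> \<open>Removing \<open>i\<close> leaves exactly the residue \<open>i mod k\<close>
    uncovered, so precisely the agents of that class complete the set.\<close>
  have Ext: "{j. j \<notin> T - {i} \<and> insert j (T - {i}) \<in> \<T>} = {j. j < n \<and> j mod k = i mod k}"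
    if T: "T \<in> \<T>" "i \<in> T" for T i
  proof (intro set_eqI iffI; clarsimp)
    have bij: "bij_betw (\<lambda>i. i mod k) T {..<k}" using T by (auto simp: \<T>_def)
    then have bij': "bij_betw (\<lambda>i. i mod k) (T - {i}) ({..<k} - {i mod k})"
      using T(2) by (auto simp: bij_betw_def inj_on_image_set_diff[of _ T] inj_on_diff)
    fix j
    {
      assume j: "insert j (T - {i}) \<in> \<T>"
      then have "(\<lambda>i. i mod k) ` insert j (T - {i}) = {..<k}" by (simp add: \<T>_def bij_betw_def)
      moreover have "(\<lambda>i. i mod k) ` (T - {i}) = {..<k} - {i mod k}" using bij' by (simp add: bij_betw_def)
      ultimately have "i mod k = j mod k" using mod_root_less(1)[of i] by (metis DiffD2 imageE image_insert insertE insertI1 lessThan_iff)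
      then show "j < n \<and> j mod k = i mod k" using j by (auto simp: \<T>_def)
    next
      assume j: "j < n" "j mod k = i mod k"
      have notin: "j \<notin> T - {i}"
        using bij T(2) j by (auto simp: bij_betw_def inj_on_def)
      have "bij_betw (\<lambda>i. i mod k) (insert j (T - {i})) (insert (i mod k) ({..<k} - {i mod k}))"
        using notIn_Un_bij_betw[OF notin _ bij'] j by simp
      then have "insert j (T - {i}) \<in> \<T>"
        using T j mod_root_less(1)[of i] by (auto simp: \<T>_def insert_absorb)
      then show "(j \<in> T \<longrightarrow> j = i) \<and> insert j (T - {i}) \<in> \<T>" using notin by auto
    }
  qed
  have "\<exists>T\<in>\<T>. (\<Sum>i\<in>T. q T i) \<le> real k * 3 / real k"
  proof (rule exists_low_sum[OF fin ne finT])
    fix T i assume T: "T \<in> \<T>" "i \<in> T"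
    let ?X = "{j. j < n \<and> j mod k = i mod k}"
    show "real k \<le> card {j. j \<notin> T - {i} \<and> insert j (T - {i}) \<in> \<T>}"
      unfolding Ext[OF T] using card_residue_class[OF mod_root_less(1), of i] by simp
    \<comment> \<open>All agents of the class want the same item, so their chances total at most 1.
      The errors, treated next, add at most \<open>n * (2 * k / n^2) \<le> 2\<close>; hence the
      bound 3.\<close>
    have "(\<Sum>j\<in>?X. q (T - {i}) j) = (\<Sum>j\<in>?X. E (T - {i}) (\<lambda>\<mu>. of_bool (\<mu> j = i mod k)))"
      by (intro sum.cong) (auto simp: q_def)
    also have "\<dots> \<le> (\<Sum>j<n. E (T - {i}) (\<lambda>\<mu>. of_bool (\<mu> j = i mod k)))"
      by (intro sum_mono2) (auto simp: E_def)
    also have "\<dots> = 1"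
      unfolding E_def using sum_expectation_items[OF J(1) P, of _ "\<lambda>j. of_bool (j = i mod k)"]
        sum_of_bool_eq[OF mod_root_less(2)] by simp
    finally have "(\<Sum>j\<in>?X. q (T - {i}) j) \<le> 1" .
    moreover have "(\<Sum>j\<in>?X. 2 * k / (real n)\<^sup>2) \<le> 2"
    proof -
      have "card ?X \<le> card {..<n}" by (intro card_mono) auto
      then have "(\<Sum>j\<in>?X. 2 * k / (real n)\<^sup>2) \<le> n * (2 * k / (real n)\<^sup>2)"
        by (simp add: divide_right_mono mult_right_mono)
      also have "\<dots> = 2 * (k / n)" by (simp add: power2_eq_square)
      also have "k / n \<le> 1" using square_le_imp_le n_pos by simp
      finally show ?thesis by simp
    qed
    ultimately show "(\<Sum>j | j \<notin> T - {i} \<and> insert j (T - {i}) \<in> \<T>. h (T - {i}) j) \<le> 3"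
      unfolding Ext[OF T] h_def sum.distrib by linarith
    show "q T i \<le> h (T - {i}) i" using T by (intro q_le) (auto simp: \<T>_def)
  qed (use k in auto)
  then obtain T where T: "T \<in> \<T>" "(\<Sum>i\<in>T. q T i) \<le> 3" using k by auto
  have "approx_ratio UnitSum n J \<le> ((\<Sum>j<n. 2 / real n + of_bool (j < k) / k) + 3) / (card T / 2)"
  proof (rule planted_profile_approx_ratio[where X = "\<lambda>i. {i mod k}" and g = "\<lambda>i. i mod k", OF J(1)])
    show "(\<Sum>i\<in>T. measure_pmf.expectation (J (planted_profile n sum_flat sum_special T))
        (\<lambda>\<mu>. of_bool (\<mu> i \<in> {i mod k}))) \<le> (3::real)"
      using T(2) by (simp add: q_def E_def P_def)
    show "inj_on (\<lambda>i. i mod k) T" "T \<subseteq> {..<n}" using T(1) by (auto simp: \<T>_def bij_betw_def)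
    show "0 < card T" using finT[OF T(1)] k by simp
  qed (intro sum_valid sum_flat_upper sum_special_upper sum_special_peak mod_root_less; assumption)+
  moreover have "(\<Sum>j<n. 2 / real n + of_bool (j < k) / k) = 3"
    using n_pos k sum_of_bool_less[OF square_le_imp_le] by (simp add: sum.distrib flip: sum_divide_distrib)
  ultimately show ?thesis using finT[OF T(1)] by simp
qed

end

section \<open>The approximation ratios\<close>

text \<open>Rounding the root down loses at most a factor 2, because the root is at least 1.\<close>

lemma sqrt_approximation:
  assumes "1 \<le> n"
  obtains k :: nat where "1 \<le> k" "k * k \<le> n" "sqrt n \<le> 2 * k"
proof
  define k where "k = nat \<lfloor>sqrt n\<rfloor>"
  have s: "1 \<le> sqrt n" using assms by simp
  then show "1 \<le> k" unfolding k_def by linarith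
  have k: "real k \<le> sqrt n" "sqrt n < real k + 1" unfolding k_def using s by linarith+
  then show "sqrt n \<le> 2 * k" using \<open>1 \<le> k\<close> by linarith
  have "real k * real k \<le> sqrt n * sqrt n" using k by (intro mult_mono) auto
  then show "k * k \<le> n" by (simp flip: of_nat_mult)
qed

lemma same_order_truthful_approx_ratio:
  assumes "admissible_size nm n" "is_mechanism nm n J" "same_order_truthful nm n J"
  shows "approx_ratio nm n J \<le> 36 / sqrt n"
proof -
  have "1 \<le> n" using assms(1) by (simp add: admissible_size_def)
  then obtain k :: nat where k: "1 \<le> k" "k * k \<le> n" "sqrt n \<le> 2 * k" by (rule sqrt_approximation)
  have "approx_ratio nm n J \<le> 18 / k"
  proof (cases nm)
    case UnitRange
    then show ?thesis using range_approx_ratio[of n k J] assms k by (simp add: admissible_size_def)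
  next
    case UnitSum
    then have "approx_ratio nm n J \<le> 12 / k" using sum_approx_ratio[of k n J] assms k by simp
    also have "\<dots> \<le> 18 / k" by (intro divide_right_mono) auto
    finally show ?thesis .
  qed
  also have "\<dots> = 36 / (2 * k)" by simp
  also have "\<dots> \<le> 36 / sqrt n" using k \<open>1 \<le> n\<close> by (intro divide_left_mono) auto
  finally show ?thesis .
qed

text \<open>Bounding the infimum in \<open>approx_ratio\<close> from below takes a non-empty set of
  profiles. The flat valuations with \<open>k = 1\<close> serve as witnesses.\<close>

lemma profiles_nonempty:
  assumes "admissible_size nm n"
  shows "profiles nm n \<noteq> {}"
proof -
  have n: "1 \<le> n" using assms by (simp add: admissible_size_def)
  have "\<exists>u. valid_valuation nm n u"
  proof (cases nm)
    case UnitRange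
    then show ?thesis using range_valid(1)[of n 1] assms by (auto simp: admissible_size_def)
  next
    case UnitSum
    then show ?thesis using sum_valid(1)[of 1 n] n by auto
  qed
  then obtain u where "valid_valuation nm n u" by blast
  then have "planted_profile n (\<lambda>_. u) (\<lambda>_. u) {} \<in> profiles nm n"
    by (intro planted_profile_in_profiles)
  then show ?thesis by blast
qed

theorem theorem1:
  fixes nm :: normalization
  shows "(\<exists>c C. c > 0 \<and> C > 0 \<and>
            (\<forall>n. admissible_size nm n \<longrightarrow>
               c / sqrt (real n) \<le> approx_ratio nm n (random_priority n) \<and>
               approx_ratio nm n (random_priority n) \<le> C / sqrt (real n)))
       \<and> (\<exists>C'. C' > 0 \<and>
            (\<forall>n J. admissible_size nm n \<longrightarrow> is_mechanism nm n J \<longrightarrow>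
               truthful_in_expectation nm n J \<longrightarrow> approx_ratio nm n J \<le> C' / sqrt (real n)))
       \<and> (\<exists>C''. C'' > 0 \<and>
            (\<forall>n J. admissible_size nm n \<longrightarrow> is_mechanism nm n J \<longrightarrow>
               ordinal_mechanism nm n J \<longrightarrow> approx_ratio nm n J \<le> C'' / sqrt (real n)))"
proof (intro conjI)
  \<comment> \<open>The upper bound for random priority comes from its being an ordinal
    mechanism.\<close>
  have "(1 / 2) / sqrt n \<le> approx_ratio nm n (random_priority n)
      \<and> approx_ratio nm n (random_priority n) \<le> 36 / sqrt n" if "admissible_size nm n" for n
    using that random_priority_approx_ratio_ge[OF profiles_nonempty[OF that]]
      same_order_truthful_approx_ratio[OF that is_mechanism_random_priority
        ordinal_imp_same_order_truthful[OF ordinal_mechanism_random_priority]]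
    by (simp add: admissible_size_def)
  then show "\<exists>c C. c > 0 \<and> C > 0 \<and>
            (\<forall>n. admissible_size nm n \<longrightarrow>
               c / sqrt (real n) \<le> approx_ratio nm n (random_priority n) \<and>
               approx_ratio nm n (random_priority n) \<le> C / sqrt (real n))"
    by (intro exI[of _ "1 / 2"] exI[of _ 36]) auto
next
  show "\<exists>C'. C' > 0 \<and>
            (\<forall>n J. admissible_size nm n \<longrightarrow> is_mechanism nm n J \<longrightarrow>
               truthful_in_expectation nm n J \<longrightarrow> approx_ratio nm n J \<le> C' / sqrt (real n))"
    using same_order_truthful_approx_ratio truthful_imp_same_order_truthful
    by (intro exI[of _ 36]) auto
  show "\<exists>C''. C'' > 0 \<and>
            (\<forall>n J. admissible_size nm n \<longrightarrow> is_mechanism nm n J \<longrightarrow>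
               ordinal_mechanism nm n J \<longrightarrow> approx_ratio nm n J \<le> C'' / sqrt (real n))"
    using same_order_truthful_approx_ratio ordinal_imp_same_order_truthful
    by (intro exI[of _ 36]) auto
qed

end
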